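(* Let $\xi_1,\dots,\xi_k$ be a family of non-vanishing vectors in $\mathbb{R}^d$ satisfying: (i) no $d$ vectors out of this family are linearly dependent; (ii) there is no $\omega\in\mathbb{R}^d$ such that $(\omega,\xi_i)>0$ for all $i$. Let $f(\xi_1),\dots,f(\xi_k)$ be arbitrary real numbers. Then $$\min_{\gamma\in\mathbb{R}^d}\max_i\,[f(\xi_i)-(\xi_i,\gamma)]=\max_I\mathbf{E}_If(\xi),$$ where the maximum on the right (over subsets $I\subset\{1,\dots,k\}$ of size $d+1$ such that $\{\xi_i\}_{i\in I}$ satisfies (ii), $\mathbf{E}_I$ being the expectation with respect to the unique risk-neutral law on $\{\xi_i\}_{i\in I}$) is the maximum of the averages $\sum_ip_if(\xi_i)$ of $f$ over all extreme points $p$ of the convex set of risk-neutral probability laws on $\{\xi_1,\dots,\xi_k\}$. All these extreme laws are given in closed form: if the support of the law is listed as $\eta_1,\dots,\eta_{d+1}$, ordered so that $\eta_2,\dots,\eta_{d+1}$ is a positively oriented basis of $\mathbb{R}^d$, then the probability of $\eta_i$ is $$\frac{(-1)^{i-1}D(\eta_1,\dots,\eta_{i-1},\eta_{i+1},\dots,\eta_{d+1})}{D(\eta_2-\eta_1,\dots,\eta_{d+1}-\eta_1)},\qquad i=1,\dots,d+1.$$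
   Context: $(\cdot,\cdot)$ is the Euclidean inner product. A probability law $\{p_i\}$ on a finite family $\{\xi_i\}$ of vectors is risk-neutral if $\sum_ip_i\xi_i=0$. For $u_1,\dots,u_d\in\mathbb{R}^d$, $D(u_1,\dots,u_d)$ is the determinant of the matrix whose $i$-th row is $u_i$. *)

theory Defs
  imports "HOL-Analysis.Analysis"
begin

text \<open>
  A family \<open>\<xi>\<^sub>1, \<dots>, \<xi>\<^sub>k\<close> in \<open>\<real>\<^sup>d\<close> is a function \<open>'k \<Rightarrow> real ^ 'd\<close>, where \<open>k = CARD('k)\<close> and
  \<open>d = CARD('d)\<close>; repetitions count, so a subfamily is a set of indices.
\<close>

definition independent_subfamily :: "('k \<Rightarrow> real ^ 'd) \<Rightarrow> 'k set \<Rightarrow> bool" where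
  "independent_subfamily \<xi> J \<longleftrightarrow> inj_on \<xi> J \<and> independent (\<xi> ` J)"

definition no_positive_direction :: "('k \<Rightarrow> real ^ 'd) \<Rightarrow> 'k set \<Rightarrow> bool" where
  "no_positive_direction \<xi> I \<longleftrightarrow> \<not> (\<exists>\<omega>. \<forall>i\<in>I. \<omega> \<bullet> \<xi> i > 0)"

text \<open>
  A law on the subfamily given by \<open>I\<close> is represented by its extension by zero to the
  whole index set, so that all laws live in the one vector space \<open>real ^ 'k\<close>.
\<close>

definition risk_neutral_laws :: "('k::finite \<Rightarrow> real ^ 'd) \<Rightarrow> 'k set \<Rightarrow> (real ^ 'k) set" where
  "risk_neutral_laws \<xi> I =
    {p. (\<forall>i. 0 \<le> p $ i) \<and> (\<forall>i. i \<notin> I \<longrightarrow> p $ i = 0) \<and> (\<Sum>i\<in>UNIV. p $ i) = 1 \<and>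
        (\<Sum>i\<in>UNIV. p $ i *\<^sub>R \<xi> i) = 0}"

definition average :: "real ^ 'k::finite \<Rightarrow> ('k \<Rightarrow> real) \<Rightarrow> real" where
  "average p f = (\<Sum>i\<in>UNIV. p $ i * f i)"

definition simplices :: "('k::finite \<Rightarrow> real ^ 'd) \<Rightarrow> 'k set set" where
  "simplices \<xi> = {I. card I = CARD('d) + 1 \<and> no_positive_direction \<xi> I}"

text \<open>Meaningful only if the risk-neutral law on the subfamily \<open>I\<close> exists and is unique.\<close>

definition risk_neutral_expectation ::
    "('k::finite \<Rightarrow> real ^ 'd) \<Rightarrow> 'k set \<Rightarrow> ('k \<Rightarrow> real) \<Rightarrow> real" where
  "risk_neutral_expectation \<xi> I f = average (THE p. p \<in> risk_neutral_laws \<xi> I) f"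

text \<open>
  The determinant with rows \<open>us\<close>, a list of length \<open>CARD('d)\<close>. The order on \<open>'d\<close> identifies
  the index \<open>r\<close> with its (zero-based) position \<open>card {..<r}\<close>.
\<close>

definition row_det :: "(real ^ 'd::{finite,linorder}) list \<Rightarrow> real" where
  "row_det us = det (\<chi> r. us ! card {..<r})"

definition positively_oriented_basis :: "(real ^ 'd::{finite,linorder}) list \<Rightarrow> bool" where
  "positively_oriented_basis us \<longleftrightarrow>
    distinct us \<and> independent (set us) \<and> span (set us) = UNIV \<and> row_det us > 0"

definition oriented_support_listing ::
    "('k::finite \<Rightarrow> real ^ 'd::{finite,linorder}) \<Rightarrow> real ^ 'k \<Rightarrow> 'k list \<Rightarrow> bool" where
  "oriented_support_listing \<xi> p js \<longleftrightarrow>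
    length js = CARD('d) + 1 \<and> distinct js \<and> set js = {i. p $ i \<noteq> 0} \<and>
    positively_oriented_basis (tl (map \<xi> js))"

text \<open>Positions are zero-based here, which turns the usual sign \<open>(-1) ^ (i - 1)\<close> into \<open>(-1) ^ i\<close>.\<close>

definition closed_form_probability :: "(real ^ 'd::{finite,linorder}) list \<Rightarrow> nat \<Rightarrow> real" where
  "closed_form_probability \<eta> i =
    (-1) ^ i * row_det (take i \<eta> @ drop (Suc i) \<eta>) / row_det (map (\<lambda>v. v - hd \<eta>) (tl \<eta>))"

end

theory Submission
  imports Defs
begin

text \<open>
  Both sides of the minimax identity are the value of a linear programme, and the proof is linear
  programming duality. Averaging \<open>f i - \<xi> i \<bullet> \<gamma>\<close> over a risk-neutral law cancels \<open>\<gamma>\<close>, so every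
  average of \<open>f\<close> is at most every maximum (\<open>average_le_Max\<close>). Let \<open>M\<close> be the largest average of
  \<open>f\<close> over the extreme laws. By the Krein-Milman theorem \<open>M\<close> bounds the averages over all laws
  (\<open>average_le_on_laws\<close>); that is, the convex hull of the points \<open>(\<xi> i, f i)\<close> does not meet the
  vertical axis above \<open>M\<close>. A hyperplane separating the two is not vertical
  (\<open>nonpositive_direction_trivial\<close>), and its slope is a vector \<open>\<gamma>\<close> with \<open>f i - \<xi> i \<bullet> \<gamma> \<le> M\<close> for all \<open>i\<close> (\<open>exists_dual_vector\<close>). Such a
  \<open>\<gamma>\<close> attains the bound, hence is a minimizer.

  General position says that a linear relation between at most \<open>d\<close> of the vectors is trivial
  (\<open>short_relation_trivial\<close>). So the support of a law has at least \<open>d + 1\<close> elements, and a set of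
  exactly \<open>d + 1\<close> indices carries at most one law. A support of \<open>d + 2\<close> or more elements leaves
  room for a perturbation. Hence the extreme laws are those whose support has \<open>d + 1\<close> elements
  (\<open>extreme_law_iff\<close>). By Gordan's alternative (\<open>no_positive_direction_iff_law\<close>) such supports
  are the simplices, so the two maxima of averages range over the same numbers.

  The closed form is Cramer's rule. For an extreme law with weights \<open>p\<^sub>0, \<dots>, p\<^sub>d\<close> on
  \<open>\<eta>\<^sub>0, \<dots>, \<eta>\<^sub>d\<close>, the vector \<open>- p\<^sub>0 \<eta>\<^sub>0\<close> is the combination of \<open>\<eta>\<^sub>1, \<dots>, \<eta>\<^sub>d\<close> with weights
  \<open>p\<^sub>1, \<dots>, p\<^sub>d\<close>, and because the total mass is one, \<open>- \<eta>\<^sub>0\<close> is the combination of the edges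
  \<open>\<eta>\<^sub>1 - \<eta>\<^sub>0, \<dots>, \<eta>\<^sub>d - \<eta>\<^sub>0\<close> with the same weights. Cramer's rule for both systems
  (\<open>barycentric_Cramer\<close>) gives the weights as quotients of the stated determinants. The signs come
  from moving the row \<open>\<eta>\<^sub>0\<close> to the front of the list (\<open>row_det_move\<close>).
\<close>

section \<open>Risk-neutral laws and convex hulls\<close>

text \<open>
  Weights are attached to indices rather than to vectors, since the family may repeat vectors. They
  come from writing the hull as a linear image of the standard simplex.
\<close>

lemma convex_hull_image_weights:
  fixes x :: "'k::finite \<Rightarrow> 'a::euclidean_space"
  assumes "y \<in> convex hull (x ` I)"
  obtains p :: "real ^ 'k" where "\<And>i. 0 \<le> p $ i" "\<And>i. i \<notin> I \<Longrightarrow> p $ i = 0"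
    "(\<Sum>i\<in>UNIV. p $ i) = 1" "(\<Sum>i\<in>UNIV. p $ i *\<^sub>R x i) = y"
proof -
  define g :: "real ^ 'k \<Rightarrow> 'a" where "g p = (\<Sum>i\<in>UNIV. p $ i *\<^sub>R x i)" for p
  define W where
    "W = {p :: real ^ 'k. (\<forall>i. 0 \<le> p $ i) \<and> (\<forall>i. i \<notin> I \<longrightarrow> p $ i = 0) \<and> (\<Sum>i\<in>UNIV. p $ i) = 1}"
  have "linear g"
    by (intro linearI)
      (simp_all add: g_def scaleR_add_left sum.distrib scaleR_sum_right)
  have g_axis: "g (axis i 1) = x i" for i
    by (simp add: g_def axis_def if_distrib[of "\<lambda>t. t *\<^sub>R _"] cong: if_cong)
  have "x ` I = g ` ((\<lambda>i. axis i 1) ` I)"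
    by (simp add: image_image g_axis)
  then have "y \<in> g ` (convex hull ((\<lambda>i. axis i 1) ` I))"
    using assms convex_hull_linear_image[OF \<open>linear g\<close>] by metis
  moreover have "convex hull ((\<lambda>i. axis i 1) ` I) \<subseteq> W"
  proof (rule hull_minimal)
    show "(\<lambda>i. axis i 1) ` I \<subseteq> W"
      by (auto simp: W_def axis_def)
    show "convex W"
      by (auto simp: convex_def W_def sum.distrib simp flip: sum_distrib_left)
  qed
  ultimately obtain p where "p \<in> W" "y = g p"
    by auto
  then show thesis
    by (intro that[of p]) (simp_all add: W_def g_def)
qed

lemma risk_neutral_laws_restrict:
  "p \<in> risk_neutral_laws \<xi> I \<longleftrightarrow> p \<in> risk_neutral_laws \<xi> UNIV \<and> {i. p $ i \<noteq> 0} \<subseteq> I"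
  by (auto simp: risk_neutral_laws_def)

text \<open>
  Gordan's alternative: either a hyperplane strictly separates the origin from the convex hull of
  the vectors, or the origin is a convex combination of them.
\<close>

lemma no_positive_direction_iff_law:
  fixes \<xi> :: "'k::finite \<Rightarrow> real ^ 'd"
  shows "no_positive_direction \<xi> I \<longleftrightarrow> risk_neutral_laws \<xi> I \<noteq> {}"
proof
  assume npd: "no_positive_direction \<xi> I"
  have "0 \<in> convex hull (\<xi> ` I)"
  proof (rule ccontr)
    assume "0 \<notin> convex hull (\<xi> ` I)"
    moreover have "closed (convex hull (\<xi> ` I))"
      by (simp add: compact_convex_hull compact_imp_closed finite_imp_compact)
    ultimately obtain a b where "0 < b" "\<forall>x\<in>convex hull (\<xi> ` I). b < a \<bullet> x"
      using separating_hyperplane_closed_0 convex_convex_hull by metis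
    then have "\<forall>i\<in>I. 0 < a \<bullet> \<xi> i"
      using hull_inc[of _ "\<xi> ` I" convex] by fastforce
    then show False
      using npd by (auto simp: no_positive_direction_def)
  qed
  then show "risk_neutral_laws \<xi> I \<noteq> {}"
    by (rule convex_hull_image_weights) (auto simp: risk_neutral_laws_def)
next
  assume "risk_neutral_laws \<xi> I \<noteq> {}"
  then obtain p where p: "\<And>i. 0 \<le> p $ i" "\<And>i. i \<notin> I \<Longrightarrow> p $ i = 0"
    "(\<Sum>i\<in>UNIV. p $ i) = 1" "(\<Sum>i\<in>UNIV. p $ i *\<^sub>R \<xi> i) = 0"
    by (auto simp: risk_neutral_laws_def)
  show "no_positive_direction \<xi> I"
    unfolding no_positive_direction_def
  proof (intro notI, elim exE)
    fix \<omega> assume \<omega>: "\<forall>i\<in>I. 0 < \<omega> \<bullet> \<xi> i"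
    have nn: "0 \<le> p $ i * (\<omega> \<bullet> \<xi> i)" for i
      using p(1,2)[of i] \<omega> by (cases "i \<in> I") auto
    have "(\<Sum>i\<in>UNIV. p $ i * (\<omega> \<bullet> \<xi> i)) = \<omega> \<bullet> (\<Sum>i\<in>UNIV. p $ i *\<^sub>R \<xi> i)"
      by (simp add: inner_sum_right)
    then have "\<forall>i. p $ i * (\<omega> \<bullet> \<xi> i) = 0"
      using nn p(4) by (simp add: sum_nonneg_eq_0_iff)
    then have "\<forall>i. p $ i = 0"
      using p(2) \<omega> by (metis less_irrefl mult_eq_0_iff)
    then show False
      using p(3) by simp
  qed
qed

lemma convex_risk_neutral_laws: "convex (risk_neutral_laws \<xi> I)"
  by (auto simp: convex_def risk_neutral_laws_def sum.distrib scaleR_add_left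
      simp flip: sum_distrib_left scaleR_scaleR scaleR_sum_right)

lemma compact_risk_neutral_laws:
  fixes \<xi> :: "'k::finite \<Rightarrow> real ^ 'd"
  shows "compact (risk_neutral_laws \<xi> I)"
proof (rule compact_eq_bounded_closed[THEN iffD2], intro conjI)
  have "norm p \<le> 1" if "p \<in> risk_neutral_laws \<xi> I" for p
    using norm_le_l1_cart[of p] that by (simp add: risk_neutral_laws_def)
  then show "bounded (risk_neutral_laws \<xi> I)"
    by (auto simp: bounded_iff)
  show "closed (risk_neutral_laws \<xi> I)"
    unfolding risk_neutral_laws_def
    by (intro closed_Collect_conj closed_Collect_all closed_Collect_imp closed_Collect_le
        closed_Collect_eq continuous_intros open_Collect_const)
qed

text \<open>
  By the Krein-Milman theorem a bound on a linear functional need only be checked at extreme points.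
\<close>

lemma average_le_on_laws:
  assumes "\<And>p. p extreme_point_of risk_neutral_laws \<xi> UNIV \<Longrightarrow> average p f \<le> M"
    and "p \<in> risk_neutral_laws \<xi> UNIV"
  shows "average p f \<le> M"
proof -
  have "p \<in> convex hull {q. q extreme_point_of risk_neutral_laws \<xi> UNIV}"
    using Krein_Milman_Minkowski[OF compact_risk_neutral_laws convex_risk_neutral_laws] assms(2)
    by blast
  moreover have "convex {q. average q f \<le> M}"
  proof -
    have "{q. average q f \<le> M} = {q. (\<chi> i. f i) \<bullet> q \<le> M}"
      by (simp add: average_def inner_vec_def mult.commute)
    then show ?thesis
      by (simp add: convex_halfspace_le)
  qed
  then have "convex hull {q. q extreme_point_of risk_neutral_laws \<xi> UNIV} \<subseteq> {q. average q f \<le> M}"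
    using assms(1) by (intro hull_minimal) auto
  ultimately show ?thesis
    by auto
qed

text \<open>
  Weak duality: risk neutrality removes \<open>\<gamma>\<close> from the average of \<open>f i - \<xi> i \<bullet> \<gamma>\<close>.
\<close>

lemma average_le_Max:
  fixes \<xi> :: "'k::finite \<Rightarrow> real ^ 'd"
  assumes p: "p \<in> risk_neutral_laws \<xi> UNIV"
  shows "average p f \<le> (MAX i. f i - \<xi> i \<bullet> \<gamma>)"
proof -
  let ?m = "MAX i. f i - \<xi> i \<bullet> \<gamma>"
  have "(\<Sum>i\<in>UNIV. p $ i * (\<xi> i \<bullet> \<gamma>)) = (\<Sum>i\<in>UNIV. p $ i *\<^sub>R \<xi> i) \<bullet> \<gamma>"
    by (simp add: inner_sum_left)
  then have "(\<Sum>i\<in>UNIV. p $ i * (\<xi> i \<bullet> \<gamma>)) = 0"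
    using p by (simp add: risk_neutral_laws_def)
  then have "average p f = (\<Sum>i\<in>UNIV. p $ i * (f i - \<xi> i \<bullet> \<gamma>))"
    by (simp add: average_def right_diff_distrib sum_subtractf)
  also have "\<dots> \<le> (\<Sum>i\<in>UNIV. p $ i * ?m)"
    using p by (intro sum_mono mult_left_mono) (auto simp: risk_neutral_laws_def)
  also have "\<dots> = ?m"
    using p by (simp add: risk_neutral_laws_def flip: sum_distrib_right)
  finally show ?thesis .
qed


section \<open>Vectors in general position\<close>

text \<open>
  Linear dependence for indexed families: a repeated vector also gives a relation, although
  it leaves no trace in the set of vectors.
\<close>

lemma nontrivial_relation:
  fixes x :: "'k::finite \<Rightarrow> 'a::euclidean_space"
  assumes "DIM('a) < card I"
  obtains c where "\<exists>i. c i \<noteq> 0" "\<And>i. i \<notin> I \<Longrightarrow> c i = 0" "(\<Sum>i\<in>UNIV. c i *\<^sub>R x i) = 0"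
proof (cases "inj_on x I")
  case True
  then have "dependent (x ` I)"
    using assms by (intro dependent_biggerset) (auto simp: card_image)
  then obtain u v where u: "v \<in> x ` I" "u v \<noteq> 0" "(\<Sum>v\<in>x ` I. u v *\<^sub>R v) = 0"
    by (auto simp: dependent_finite)
  have "(\<Sum>i\<in>UNIV. (if i \<in> I then u (x i) else 0) *\<^sub>R x i) = (\<Sum>i\<in>I. u (x i) *\<^sub>R x i)"
    by (simp add: if_distrib[of "\<lambda>t. t *\<^sub>R _"] sum.If_cases cong: if_cong)
  also have "\<dots> = 0"
    using True u(3) by (simp add: sum.reindex)
  finally show thesis
    using u(1,2) by (intro that[of "\<lambda>i. if i \<in> I then u (x i) else 0"]) auto
next
  case False
  then obtain i j where ij: "i \<in> I" "j \<in> I" "i \<noteq> j" "x i = x j"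
    by (auto simp: inj_on_def)
  have "(\<Sum>l\<in>UNIV. (of_bool (l = i) - of_bool (l = j)) *\<^sub>R x l) = 0"
    using ij(4) by (simp add: scaleR_diff_left sum_subtractf of_bool_def
        if_distrib[of "\<lambda>t. t *\<^sub>R _"] cong: if_cong)
  then show thesis
    using ij by (intro that[of "\<lambda>l. of_bool (l = i) - of_bool (l = j)"]) (auto simp: of_bool_def)
qed

locale general_position =
  fixes \<xi> :: "'k::finite \<Rightarrow> real ^ 'd"
  assumes size: "CARD('d) \<le> CARD('k)"
    and independent: "card J = CARD('d) \<Longrightarrow> independent_subfamily \<xi> J"
begin

text \<open>
  A set of fewer than \<open>d\<close> indices extends to one of \<open>d\<close>, because the family is long enough.
\<close>

lemma short_relation_trivial:
  assumes card: "card {i. c i \<noteq> 0} \<le> CARD('d)" and rel: "(\<Sum>i\<in>UNIV. c i *\<^sub>R \<xi> i) = 0"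
  shows "c i = 0"
proof (rule ccontr)
  assume "c i \<noteq> 0"
  obtain J where J: "{i. c i \<noteq> 0} \<subseteq> J" "card J = CARD('d)"
    using exists_subset_between[OF card size] by auto
  have inj: "inj_on \<xi> J" and ind: "independent (\<xi> ` J)"
    using independent[OF J(2)] by (auto simp: independent_subfamily_def)
  have "(\<Sum>v\<in>\<xi> ` J. c (inv_into J \<xi> v) *\<^sub>R v) = (\<Sum>i\<in>J. c i *\<^sub>R \<xi> i)"
    using inj by (simp add: sum.reindex)
  also have "\<dots> = (\<Sum>i\<in>UNIV. c i *\<^sub>R \<xi> i)"
    using J(1) by (intro sum.mono_neutral_left) auto
  finally have "c (inv_into J \<xi> (\<xi> i)) = 0"
    using ind rel J(1) \<open>c i \<noteq> 0\<close>
    by (intro independentD[of "\<xi> ` J" "\<xi> ` J" "\<lambda>v. c (inv_into J \<xi> v)"]) auto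
  then show False
    using inj J(1) \<open>c i \<noteq> 0\<close> by (auto simp: inv_into_f_f subset_iff)
qed

lemma span_subfamily:
  assumes "card J = CARD('d)"
  shows "span (\<xi> ` J) = UNIV"
proof -
  have "card (\<xi> ` J) = DIM(real ^ 'd)" "independent (\<xi> ` J)"
    using independent[OF assms] assms by (auto simp: independent_subfamily_def card_image)
  then show ?thesis
    by (metis dim_eq_card_independent dim_eq_full)
qed

lemma card_support_law:
  assumes "p \<in> risk_neutral_laws \<xi> UNIV"
  shows "CARD('d) < card {i. p $ i \<noteq> 0}"
proof (rule ccontr)
  assume "\<not> ?thesis"
  then have "p $ i = 0" for i
    using assms by (intro short_relation_trivial) (auto simp: risk_neutral_laws_def)
  then show False
    using assms by (simp add: risk_neutral_laws_def)
qed

lemma support_law_eq: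
  assumes "p \<in> risk_neutral_laws \<xi> I" and "card I = CARD('d) + 1"
  shows "{i. p $ i \<noteq> 0} = I"
proof (rule card_seteq)
  show "{i. p $ i \<noteq> 0} \<subseteq> I" "card I \<le> card {i. p $ i \<noteq> 0}"
    using assms card_support_law[of p] risk_neutral_laws_restrict[of p \<xi> I] by auto
qed simp

text \<open>
  Subtracting from one law the multiple of the other that cancels one coordinate leaves a relation
  between at most \<open>d\<close> of the vectors; so the laws are proportional.
\<close>

lemma law_unique:
  assumes p: "p \<in> risk_neutral_laws \<xi> I" and q: "q \<in> risk_neutral_laws \<xi> I"
    and I: "card I = CARD('d) + 1"
  shows "p = q"
proof -
  obtain j where "j \<in> I"
    using I by fastforce
  then have "q $ j \<noteq> 0"
    using support_law_eq[OF q I] by auto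
  define t where "t = p $ j / q $ j"
  have supp: "{i. p $ i - t * q $ i \<noteq> 0} \<subseteq> I - {j}"
    using p q \<open>q $ j \<noteq> 0\<close> by (force simp: risk_neutral_laws_def t_def)
  have "card {i. p $ i - t * q $ i \<noteq> 0} \<le> CARD('d)"
    using card_mono[OF _ supp] I \<open>j \<in> I\<close> by simp
  moreover have "(\<Sum>i\<in>UNIV. (p $ i - t * q $ i) *\<^sub>R \<xi> i) = 0"
    using p q by (simp add: risk_neutral_laws_def scaleR_diff_left sum_subtractf
        flip: scaleR_scaleR scaleR_sum_right)
  ultimately have eq: "p $ i = t * q $ i" for i
    using short_relation_trivial[of "\<lambda>i. p $ i - t * q $ i" i] by simp
  have "(\<Sum>i\<in>UNIV. p $ i) = t * (\<Sum>i\<in>UNIV. q $ i)"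
    by (simp add: eq sum_distrib_left)
  then have "t = 1"
    using p q by (simp add: risk_neutral_laws_def)
  then show "p = q"
    by (simp add: vec_eq_iff eq)
qed

text \<open>
  A larger support carries a signed measure of total mass and mean zero, along which the law can
  be moved a little in both directions.
\<close>

lemma extreme_law_card_support_le:
  assumes ext: "p extreme_point_of risk_neutral_laws \<xi> UNIV"
  shows "card {i. p $ i \<noteq> 0} \<le> CARD('d) + 1"
proof (rule ccontr)
  define I where "I = {i. p $ i \<noteq> 0}"
  assume "\<not> ?thesis"
  \<comment> \<open>The extra coordinate \<open>1\<close> makes a relation between the vectors one of total mass zero as well.\<close>
  then have "DIM((real ^ 'd) \<times> real) < card I"
    by (simp add: I_def)
  then obtain c where c: "\<exists>i. c i \<noteq> 0" "\<And>i. i \<notin> I \<Longrightarrow> c i = 0"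
    and sum_c: "(\<Sum>i\<in>UNIV. c i *\<^sub>R (\<xi> i, 1 :: real)) = 0"
    by (rule nontrivial_relation[where x = "\<lambda>i. (\<xi> i, 1)"]) blast
  have "(\<Sum>i\<in>UNIV. c i *\<^sub>R \<xi> i) = fst (\<Sum>i\<in>UNIV. c i *\<^sub>R (\<xi> i, 1 :: real))"
    by (simp add: fst_sum)
  then have rel: "(\<Sum>i\<in>UNIV. c i *\<^sub>R \<xi> i) = 0"
    by (simp only: sum_c) simp
  have "(\<Sum>i\<in>UNIV. c i) = snd (\<Sum>i\<in>UNIV. c i *\<^sub>R (\<xi> i, 1 :: real))"
    by (simp add: snd_sum)
  then have mass: "(\<Sum>i\<in>UNIV. c i) = 0"
    by (simp only: sum_c) simp
  have p: "p \<in> risk_neutral_laws \<xi> UNIV"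
    using ext by (simp add: extreme_point_of_def)
  have pos: "0 < p $ i" if "i \<in> I" for i
    using p that by (auto simp: I_def risk_neutral_laws_def less_le)
  \<comment> \<open>The \<open>1\<close> avoids division by zero at indices where \<open>c\<close> vanishes.\<close>
  define \<epsilon> where "\<epsilon> = (MIN i\<in>I. p $ i / (1 + \<bar>c i\<bar>))"
  have "I \<noteq> {}"
    using c by auto
  have "0 < \<epsilon>"
    using \<open>I \<noteq> {}\<close> pos by (auto simp: \<epsilon>_def intro!: divide_pos_pos add_pos_nonneg)
  have small: "\<epsilon> * \<bar>c i\<bar> \<le> p $ i" for i
  proof (cases "i \<in> I")
    case True
    then have "\<epsilon> \<le> p $ i / (1 + \<bar>c i\<bar>)"
      by (simp add: \<epsilon>_def)
    then have "\<epsilon> * (1 + \<bar>c i\<bar>) \<le> p $ i"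
      by (simp add: pos_le_divide_eq add_pos_nonneg)
    then show ?thesis
      using \<open>0 < \<epsilon>\<close> by (simp add: distrib_left)
  qed (use c(2) in \<open>simp add: I_def\<close>)
  define q where "q s = (\<chi> i. p $ i + s * c i)" for s
  have law: "q s \<in> risk_neutral_laws \<xi> UNIV" if "\<bar>s\<bar> = \<epsilon>" for s
  proof -
    have "\<bar>s * c i\<bar> \<le> p $ i" for i
      using small[of i] that by (simp add: abs_mult)
    then have "0 \<le> p $ i + s * c i" for i
      using abs_le_D2[of "s * c i" "p $ i"] by simp
    then show ?thesis
      using p rel mass by (simp add: risk_neutral_laws_def q_def scaleR_add_left sum.distrib
          flip: sum_distrib_left scaleR_scaleR scaleR_sum_right)
  qed
  obtain i where "c i \<noteq> 0"
    using c(1) by blast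
  then have "q \<epsilon> $ i \<noteq> q (- \<epsilon>) $ i"
    using \<open>0 < \<epsilon>\<close> by (simp add: q_def)
  then have "q \<epsilon> \<noteq> q (- \<epsilon>)"
    by metis
  moreover have "p = midpoint (q \<epsilon>) (q (- \<epsilon>))"
    by (simp add: vec_eq_iff q_def midpoint_def)
  ultimately have "p \<in> open_segment (q \<epsilon>) (q (- \<epsilon>))"
    by (simp add: midpoint_in_open_segment)
  then show False
    using ext law[of \<epsilon>] law[of "- \<epsilon>"] \<open>0 < \<epsilon>\<close> by (simp add: extreme_point_of_def)
qed

text \<open>
  Conversely, two laws with \<open>p\<close> strictly between them can only charge the support of \<open>p\<close>, by
  nonnegativity; on \<open>d + 1\<close> indices they must then coincide.
\<close>

lemma extreme_law_iff:
  "p extreme_point_of risk_neutral_laws \<xi> UNIV \<longleftrightarrow>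
    p \<in> risk_neutral_laws \<xi> UNIV \<and> card {i. p $ i \<noteq> 0} = CARD('d) + 1"
proof
  assume "p extreme_point_of risk_neutral_laws \<xi> UNIV"
  then show "p \<in> risk_neutral_laws \<xi> UNIV \<and> card {i. p $ i \<noteq> 0} = CARD('d) + 1"
    using extreme_law_card_support_le card_support_law[of p]
    by (fastforce simp: extreme_point_of_def)
next
  assume p: "p \<in> risk_neutral_laws \<xi> UNIV \<and> card {i. p $ i \<noteq> 0} = CARD('d) + 1"
  define I where "I = {i. p $ i \<noteq> 0}"
  show "p extreme_point_of risk_neutral_laws \<xi> UNIV"
    unfolding extreme_point_of_def
  proof (intro conjI ballI notI)
    fix a b
    assume a: "a \<in> risk_neutral_laws \<xi> UNIV" and b: "b \<in> risk_neutral_laws \<xi> UNIV"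
      and seg: "p \<in> open_segment a b"
    then obtain u where u: "0 < u" "u < 1" "p = (1 - u) *\<^sub>R a + u *\<^sub>R b" and "a \<noteq> b"
      by (auto simp: in_segment)
    have "a $ i = 0 \<and> b $ i = 0" if "p $ i = 0" for i
    proof -
      have "0 \<le> a $ i" "0 \<le> b $ i"
        using a b by (auto simp: risk_neutral_laws_def)
      moreover have "(1 - u) * a $ i + u * b $ i = 0"
        using that u(3) by simp
      ultimately show ?thesis
        using u(1,2) by (simp add: add_nonneg_eq_0_iff)
    qed
    then have "a \<in> risk_neutral_laws \<xi> I" "b \<in> risk_neutral_laws \<xi> I"
      using a b by (auto simp: risk_neutral_laws_def I_def)
    then show False
      using law_unique[of a I b] p \<open>a \<noteq> b\<close> by (simp add: I_def)
  qed (use p in simp)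
qed

lemma law_in_simplex_iff_extreme:
  assumes "I \<in> simplices \<xi>"
  shows "p \<in> risk_neutral_laws \<xi> I \<longleftrightarrow>
    p extreme_point_of risk_neutral_laws \<xi> UNIV \<and> {i. p $ i \<noteq> 0} = I"
proof
  assume p: "p \<in> risk_neutral_laws \<xi> I"
  have "card I = CARD('d) + 1"
    using assms by (simp add: simplices_def)
  then have "{i. p $ i \<noteq> 0} = I" "card I = CARD('d) + 1"
    using support_law_eq[OF p] by blast+
  moreover have "p \<in> risk_neutral_laws \<xi> UNIV"
    using p risk_neutral_laws_restrict by blast
  ultimately show "p extreme_point_of risk_neutral_laws \<xi> UNIV \<and> {i. p $ i \<noteq> 0} = I"
    unfolding extreme_law_iff by blast
next
  assume "p extreme_point_of risk_neutral_laws \<xi> UNIV \<and> {i. p $ i \<noteq> 0} = I"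
  then show "p \<in> risk_neutral_laws \<xi> I"
    unfolding extreme_point_of_def using risk_neutral_laws_restrict by blast
qed

lemma ex1_law_in_simplex:
  assumes "I \<in> simplices \<xi>"
  shows "\<exists>!p. p \<in> risk_neutral_laws \<xi> I"
proof -
  have I: "card I = CARD('d) + 1" "risk_neutral_laws \<xi> I \<noteq> {}"
    using assms unfolding simplices_def no_positive_direction_iff_law by blast+
  then show ?thesis
    using law_unique[OF _ _ I(1)] by blast
qed

lemma support_extreme_law_in_simplices:
  assumes "p extreme_point_of risk_neutral_laws \<xi> UNIV"
  shows "{i. p $ i \<noteq> 0} \<in> simplices \<xi>"
proof -
  have "p \<in> risk_neutral_laws \<xi> UNIV" "card {i. p $ i \<noteq> 0} = CARD('d) + 1"
    using assms unfolding extreme_law_iff by blast+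
  then show ?thesis
    unfolding simplices_def no_positive_direction_iff_law
    using risk_neutral_laws_restrict by blast
qed

text \<open>
  Taking supports is a bijection from extreme laws to simplices. This is why the maximum
  over simplices is the maximum over extreme laws.
\<close>

lemma extreme_laws_eq_simplex_laws:
  "{p. p extreme_point_of risk_neutral_laws \<xi> UNIV} =
    (\<lambda>I. THE p. p \<in> risk_neutral_laws \<xi> I) ` simplices \<xi>" (is "?E = ?F")
proof
  show "?F \<subseteq> ?E"
    using theI'[OF ex1_law_in_simplex] law_in_simplex_iff_extreme by blast
  show "?E \<subseteq> ?F"
  proof
    fix p assume "p \<in> ?E"
    then have p: "p extreme_point_of risk_neutral_laws \<xi> UNIV"
      by simp
    note I = support_extreme_law_in_simplices[OF p]
    have "p \<in> risk_neutral_laws \<xi> {i. p $ i \<noteq> 0}"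
      unfolding law_in_simplex_iff_extreme[OF I] using p by simp
    then have "p = (THE p'. p' \<in> risk_neutral_laws \<xi> {i. p $ i \<noteq> 0})"
      by (rule the1_equality[OF ex1_law_in_simplex[OF I], symmetric])
    then show "p \<in> ?F"
      using I by (rule image_eqI)
  qed
qed

text \<open>
  Averaging over \<open>p\<close> shows that \<open>p\<close> is concentrated on the hyperplane orthogonal to \<open>\<omega>\<close>. If
  \<open>\<omega> \<noteq> 0\<close>, that hyperplane cannot hold the more than \<open>d\<close> vectors of its support.
\<close>

lemma nonpositive_direction_trivial:
  assumes p: "p \<in> risk_neutral_laws \<xi> UNIV" and \<omega>: "\<And>i. \<omega> \<bullet> \<xi> i \<le> 0"
  shows "\<omega> = 0"
proof -
  define I where "I = {i. p $ i \<noteq> 0}"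
  have nn: "0 \<le> - (p $ i * (\<omega> \<bullet> \<xi> i))" for i
    using p \<omega>[of i] by (simp add: risk_neutral_laws_def mult_nonneg_nonpos)
  have "(\<Sum>i\<in>UNIV. - (p $ i * (\<omega> \<bullet> \<xi> i))) = - (\<omega> \<bullet> (\<Sum>i\<in>UNIV. p $ i *\<^sub>R \<xi> i))"
    by (simp add: inner_sum_right sum_negf)
  then have "\<forall>i. - (p $ i * (\<omega> \<bullet> \<xi> i)) = 0"
    using nn p by (simp add: sum_nonneg_eq_0_iff[of UNIV] risk_neutral_laws_def)
  then have orth: "\<omega> \<bullet> \<xi> i = 0" if "i \<in> I" for i
    using that by (auto simp: I_def)
  have "CARD('d) \<le> card I"
    using card_support_law[OF p] by (simp add: I_def)
  then obtain J where J: "J \<subseteq> I" "card J = CARD('d)"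
    by (rule obtain_subset_with_card_n)
  have "span (\<xi> ` J) = UNIV"
    using span_subfamily[OF J(2)] .
  then have "\<omega> \<in> span (\<xi> ` J)"
    by simp
  moreover have "orthogonal \<omega> x" if "x \<in> \<xi> ` J" for x
    using that J(1) orth by (auto simp: orthogonal_def)
  ultimately have "orthogonal \<omega> \<omega>"
    by (rule orthogonal_to_span)
  then show ?thesis
    by (simp add: orthogonal_def)
qed

text \<open>
  Strong duality: the convex hull of the points \<open>(\<xi> i, f i)\<close> misses the part of the vertical axis
  above height \<open>M\<close>. A separating hyperplane is not vertical, since its normal would
  otherwise be a direction excluded by the preceding lemma; its slope is \<open>\<gamma>\<close>.
\<close>

lemma exists_dual_vector:
  assumes law: "risk_neutral_laws \<xi> UNIV \<noteq> {}"
    and M: "\<And>p. p \<in> risk_neutral_laws \<xi> UNIV \<Longrightarrow> average p f \<le> M"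
  obtains \<gamma> where "\<And>i. f i - \<xi> i \<bullet> \<gamma> \<le> M"
proof -
  define S where "S = convex hull (range (\<lambda>i. (\<xi> i, f i)))"
  define T where "T = {0 :: real ^ 'd} \<times> {M<..}"
  have "S \<inter> T = {}"
  proof (rule ccontr)
    assume "S \<inter> T \<noteq> {}"
    then obtain h where "(0, h) \<in> S" and "M < h"
      by (auto simp: T_def)
    from this(1)[unfolded S_def] obtain p :: "real ^ 'k" where p: "\<And>i. 0 \<le> p $ i" "(\<Sum>i\<in>UNIV. p $ i) = 1"
      and sum_p: "(\<Sum>i\<in>UNIV. p $ i *\<^sub>R (\<xi> i, f i)) = (0, h)"
      by (rule convex_hull_image_weights) blast
    have "(\<Sum>i\<in>UNIV. p $ i *\<^sub>R \<xi> i) = fst (\<Sum>i\<in>UNIV. p $ i *\<^sub>R (\<xi> i, f i))"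
      by (simp add: fst_sum)
    moreover have "average p f = snd (\<Sum>i\<in>UNIV. p $ i *\<^sub>R (\<xi> i, f i))"
      by (simp add: snd_sum average_def)
    ultimately have "p \<in> risk_neutral_laws \<xi> UNIV" "average p f = h"
      using p by (simp_all only: sum_p) (simp_all add: risk_neutral_laws_def)
    then show False
      using M[of p] \<open>M < h\<close> by simp
  qed
  moreover have "convex S" "convex T" "S \<noteq> {}" "T \<noteq> {}"
    by (auto simp: S_def T_def convex_Times)
  ultimately obtain a b where a: "a \<noteq> 0" and S: "\<forall>x\<in>S. a \<bullet> x \<le> b" and T: "\<forall>x\<in>T. b \<le> a \<bullet> x"
    using separating_hyperplane_sets[of S T] by blast
  obtain \<omega> \<beta> where a_eq: "a = (\<omega>, \<beta>)"
    by (cases a)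
  have S': "\<omega> \<bullet> \<xi> i + \<beta> * f i \<le> b" for i
    using S[rule_format, of "(\<xi> i, f i)"] by (simp add: S_def a_eq hull_inc)
  have T': "b \<le> \<beta> * h" if "M < h" for h
    using T[rule_format, of "(0, h)"] that by (simp add: T_def a_eq)
  have bM: "b \<le> \<beta> * M"
  proof (rule tendsto_lowerbound)
    show "((\<lambda>h. \<beta> * h) \<longlongrightarrow> \<beta> * M) (at_right M)"
      by (intro tendsto_intros)
    show "\<forall>\<^sub>F h in at_right M. b \<le> \<beta> * h"
      using T' eventually_at_right_less[of M] by (rule eventually_mono[rotated])
  qed simp
  obtain p where p: "p \<in> risk_neutral_laws \<xi> UNIV"
    using law by blast
  \<comment> \<open>Average the bound on the hull with respect to any law and compare with a point of the axis.\<close>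
  have "0 \<le> \<beta>"
  proof -
    have "(\<Sum>i\<in>UNIV. p $ i * (\<omega> \<bullet> \<xi> i)) = \<omega> \<bullet> (\<Sum>i\<in>UNIV. p $ i *\<^sub>R \<xi> i)"
      by (simp add: inner_sum_right)
    then have "\<beta> * average p f = (\<Sum>i\<in>UNIV. p $ i * (\<omega> \<bullet> \<xi> i + \<beta> * f i))"
      using p by (simp add: risk_neutral_laws_def average_def distrib_left sum.distrib
          sum_distrib_left mult.left_commute)
    also have "\<dots> \<le> (\<Sum>i\<in>UNIV. p $ i * b)"
      using p S' by (intro sum_mono mult_left_mono) (auto simp: risk_neutral_laws_def)
    also have "\<dots> = b"
      using p by (simp add: risk_neutral_laws_def flip: sum_distrib_right)
    also have "\<dots> \<le> \<beta> * (M + 1)"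
      using T' by simp
    finally have "0 \<le> \<beta> * (M + 1 - average p f)"
      by (simp add: right_diff_distrib)
    then show ?thesis
      using M[OF p] by (simp add: zero_le_mult_iff)
  qed
  moreover have "\<beta> \<noteq> 0"
  proof
    assume "\<beta> = 0"
    then have "\<omega> \<bullet> \<xi> i \<le> 0" for i
      using S'[of i] bM by simp
    then have "\<omega> = 0"
      by (rule nonpositive_direction_trivial[OF p])
    then show False
      using a \<open>\<beta> = 0\<close> by (simp add: a_eq zero_prod_def)
  qed
  ultimately have "0 < \<beta>"
    by simp
  show thesis
  proof (rule that)
    fix i
    have "f i - \<xi> i \<bullet> (- (\<omega> /\<^sub>R \<beta>)) = (\<omega> \<bullet> \<xi> i + \<beta> * f i) / \<beta>"
      using \<open>0 < \<beta>\<close> by (simp add: field_simps inner_commute)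
    also have "\<dots> \<le> M"
      using S'[of i] bM \<open>0 < \<beta>\<close> by (simp add: pos_divide_le_eq mult.commute)
    finally show "f i - \<xi> i \<bullet> (- (\<omega> /\<^sub>R \<beta>)) \<le> M" .
  qed
qed

end


section \<open>Determinants and lists of rows\<close>

text \<open>
  Subtracting \<open>x\<close> from the other rows is a sequence of row operations; the induction is on the
  set \<open>S\<close> of rows already treated.
\<close>

lemma det_subtract_row:
  fixes a :: "'d::finite \<Rightarrow> real ^ 'd"
  shows "det (\<chi> r. if r = k then x else a r - x) = det (\<chi> r. if r = k then x else a r)"
proof -
  have "det (\<chi> r. if r = k then x else if r \<in> S then a r - x else a r) =
      det (\<chi> r. if r = k then x else a r)" if "k \<notin> S" "finite S" for S
    using that(2,1)
  proof (induction S)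
    case (insert s S)
    define A where "A = (\<chi> r. if r = k then x else if r \<in> S then a r - x else a r)"
    have "s \<noteq> k"
      using insert.prems by auto
    have "(\<chi> r. if r = k then x else if r \<in> insert s S then a r - x else a r) =
        (\<chi> r. if r = s then row s A + (- 1) *s row k A else row r A)"
      using insert.hyps(2) \<open>s \<noteq> k\<close> by (auto simp: vec_eq_iff A_def row_def)
    then show ?case
      using insert det_row_operation[OF \<open>s \<noteq> k\<close>, of A "- 1"] by (simp add: A_def)
  qed (simp cong: if_cong)
  from this[of "- {k}"] show ?thesis
    by (simp cong: if_cong)
qed

lemma det_replace_row_by_combination:
  fixes A :: "real ^ 'd ^ 'd"
  shows "det (\<chi> r. if r = k then \<Sum>r\<in>UNIV. c r *\<^sub>R A $ r else A $ r) = c k * det A"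
proof -
  have "row r A = A $ r" for r
    by (simp add: row_def vec_eq_iff)
  then show ?thesis
    using cramer_lemma_transpose[of k "\<chi> r. c r" A]
    by (simp add: scalar_mult_eq_scaleR cong: if_cong)
qed

text \<open>
  Cramer's rule, applied to \<open>- c0 *\<^sub>R x\<close> as a combination of the rows \<open>a r\<close> and then to \<open>- x\<close> as the
  combination of the rows \<open>a r - x\<close> with the same weights. The two right-hand sides share a
  determinant, which ties the weights to \<open>det (\<chi> r. a r - x)\<close>.
\<close>

lemma barycentric_Cramer:
  fixes a :: "'d::finite \<Rightarrow> real ^ 'd"
  assumes rel: "c0 *\<^sub>R x + (\<Sum>r\<in>UNIV. c r *\<^sub>R a r) = 0" and mass: "c0 + (\<Sum>r\<in>UNIV. c r) = 1"
  shows "c0 * det (\<chi> r. if r = k then x else a r) = - (c k * det (\<chi> r. a r))"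
    and "c k * det (\<chi> r. a r - x) = - det (\<chi> r. if r = k then x else a r)"
proof -
  have neg: "det (\<chi> r. if r = k then t *\<^sub>R x else b r) = t * det (\<chi> r. if r = k then x else b r)"
    for t and b :: "'d \<Rightarrow> real ^ 'd"
    using det_row_mul[of k t "\<lambda>_. x" b]
    by (simp add: scalar_mult_eq_scaleR cong: if_cong)
  have sum_a: "(\<Sum>r\<in>UNIV. c r *\<^sub>R a r) = (- c0) *\<^sub>R x"
    using rel by (simp add: eq_neg_iff_add_eq_0 add.commute)
  have "c k * det (\<chi> r. a r) = det (\<chi> r. if r = k then (- c0) *\<^sub>R x else a r)"
    unfolding sum_a[symmetric]
    by (simp flip: det_replace_row_by_combination cong: if_cong)
  then show "c0 * det (\<chi> r. if r = k then x else a r) = - (c k * det (\<chi> r. a r))"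
    by (simp only: neg)
  have "(\<Sum>r\<in>UNIV. c r *\<^sub>R (a r - x)) = (\<Sum>r\<in>UNIV. c r *\<^sub>R a r) - (\<Sum>r\<in>UNIV. c r) *\<^sub>R x"
    by (simp add: scaleR_diff_right sum_subtractf scaleR_sum_left)
  also have "\<dots> = (- 1) *\<^sub>R x"
    using mass unfolding sum_a
    by (metis add.inverse_inverse diff_conv_add_uminus minus_add_distrib scaleR_left.diff)
  finally have eq: "(\<Sum>r\<in>UNIV. c r *\<^sub>R (a r - x)) = (- 1) *\<^sub>R x" .
  have "c k * det (\<chi> r. a r - x) = det (\<chi> r. if r = k then (- 1) *\<^sub>R x else a r - x)"
    unfolding eq[symmetric]
    by (simp flip: det_replace_row_by_combination cong: if_cong)
  also have "\<dots> = - det (\<chi> r. if r = k then x else a r)"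
    by (simp only: neg det_subtract_row)
  finally show "c k * det (\<chi> r. a r - x) = - det (\<chi> r. if r = k then x else a r)" .
qed

lemma bij_betw_card_lessThan:
  "bij_betw (\<lambda>r. card {..<r}) (UNIV :: 'd::{finite,linorder} set) {..<CARD('d)}"
proof -
  have mono: "card {..<r} < card {..<s}" if "r < s" for r s :: 'd
    using that by (intro psubset_card_mono) auto
  have inj: "inj (\<lambda>r :: 'd. card {..<r})"
  proof (rule injI)
    fix r s :: 'd assume "card {..<r} = card {..<s}"
    then show "r = s"
      using mono[of r s] mono[of s r] by (cases r s rule: linorder_cases) auto
  qed
  have "card {..<r} < CARD('d)" for r :: 'd
    by (intro psubset_card_mono) auto
  then have "range (\<lambda>r :: 'd. card {..<r}) \<subseteq> {..<CARD('d)}"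
    by auto
  then show ?thesis
    using inj by (simp add: bij_betw_def card_image card_subset_eq)
qed

lemma row_det_swap:
  fixes x y :: "real ^ 'd::{finite,linorder}"
  assumes "length (as @ x # y # bs) = CARD('d)"
  shows "row_det (as @ y # x # bs) = - row_det (as @ x # y # bs)"
proof -
  have "length as \<in> (\<lambda>r :: 'd. card {..<r}) ` UNIV" "Suc (length as) \<in> (\<lambda>r :: 'd. card {..<r}) ` UNIV"
    using assms bij_betw_card_lessThan[where 'd='d] by (simp_all add: bij_betw_def)
  then obtain r s :: 'd where rs: "card {..<r} = length as" "card {..<s} = Suc (length as)"
    by force
  have inj: "card {..<i} = card {..<j} \<longleftrightarrow> i = j" for i j :: 'd
    using bij_betw_card_lessThan[where 'd='d] by (auto simp: bij_betw_def dest: injD)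
  have "r \<noteq> s"
    using rs by auto
  have "(as @ y # x # bs) ! card {..<i} = (as @ x # y # bs) ! card {..<Transposition.transpose r s i}" for i :: 'd
  proof -
    consider "i = r" | "i = s" | "i \<noteq> r" "i \<noteq> s"
      by blast
    then show ?thesis
    proof cases
      case 3
      then have "card {..<i} \<noteq> length as" "card {..<i} \<noteq> Suc (length as)"
        using rs inj by metis+
      then show ?thesis
        using 3 by (auto simp: nth_append nth_Cons split: nat.splits)
    qed (use rs in \<open>simp_all add: nth_append\<close>)
  qed
  then have "row_det (as @ y # x # bs) =
      det (\<chi> i. (\<chi> r. (as @ x # y # bs) ! card {..<r}) $ Transposition.transpose r s i)"
    by (simp add: row_det_def)
  also have "\<dots> = - row_det (as @ x # y # bs)"
    by (subst det_permute_rows)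
      (simp_all add: permutes_swap_id sign_swap_id \<open>r \<noteq> s\<close> row_det_def)
  finally show ?thesis .
qed

text \<open>Carrying a row across \<open>length bs\<close> others takes that many swaps of neighbours.\<close>

lemma row_det_move:
  fixes x :: "real ^ 'd::{finite,linorder}"
  assumes "length (as @ x # bs @ cs) = CARD('d)"
  shows "row_det (as @ x # bs @ cs) = (- 1) ^ length bs * row_det (as @ bs @ x # cs)"
  using assms
proof (induction bs arbitrary: as)
  case (Cons b bs)
  have "row_det (as @ x # b # bs @ cs) = - row_det (as @ b # x # bs @ cs)"
    using Cons.prems by (intro row_det_swap) auto
  then show ?case
    using Cons.IH[of "as @ [b]"] Cons.prems by simp
qed simp

lemma row_det_nonzero:
  fixes us :: "(real ^ 'd::{finite,linorder}) list"
  assumes "length us = CARD('d)" and "span (set us) = UNIV"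
  shows "row_det us \<noteq> 0"
proof -
  define A where "A = (\<chi> r :: 'd. us ! card {..<r})"
  have "rows A = (\<lambda>r. us ! card {..<r}) ` (UNIV :: 'd set)"
    by (auto simp: rows_def row_def A_def)
  also have "\<dots> = (!) us ` {..<length us}"
    using bij_betw_card_lessThan[where 'd='d] assms(1) unfolding bij_betw_def by (metis image_image)
  also have "\<dots> = set us"
    by (auto simp: set_conv_nth)
  finally have "invertible A"
    using assms(2) matrix_left_invertible_span_rows[of A] by (simp add: invertible_left_inverse)
  then show ?thesis
    by (simp add: row_det_def A_def invertible_det_nz)
qed

text \<open>
  Cramer's rule produces determinants in which \<open>x\<close> stands in place of the deleted row, whereas the
  closed form has it in front; moving it past \<open>i\<close> rows accounts for the sign.
\<close>

lemma row_det_delete: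
  fixes x :: "real ^ 'd::{finite,linorder}"
  assumes "length us = CARD('d)" and "i < CARD('d)"
  shows "row_det (take (Suc i) (x # us) @ drop (Suc (Suc i)) (x # us)) =
    (- 1) ^ i * row_det (us[i := x])"
  using row_det_move[of "[]" x "take i us" "drop (Suc i) us"] assms
  by (simp add: upd_conv_take_nth_drop)

lemma row_det_Cramer:
  fixes x :: "real ^ 'd::{finite,linorder}"
  assumes len: "length us = CARD('d)" and i: "i < CARD('d)"
    and rel: "c0 *\<^sub>R x + (\<Sum>i<CARD('d). c i *\<^sub>R us ! i) = 0"
    and mass: "c0 + (\<Sum>i<CARD('d). c i) = 1"
  shows "c0 * row_det (us[i := x]) = - (c i * row_det us)"
    and "c i * row_det (map (\<lambda>v. v - x) us) = - row_det (us[i := x])"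
proof -
  note bij = bij_betw_card_lessThan[where 'd='d]
  obtain k :: 'd where k: "card {..<k} = i"
    using bij i by (auto simp: bij_betw_def image_iff set_eq_iff) (metis lessThan_iff)
  have eq: "card {..<r} = i \<longleftrightarrow> r = k" for r :: 'd
    using bij k by (auto simp: bij_betw_def dest: injD)
  have lt: "card {..<r} < CARD('d)" for r :: 'd
    using bij by (auto simp: bij_betw_def)
  define a where "a r = us ! card {..<r}" for r :: 'd
  have upd: "row_det (us[i := x]) = det (\<chi> r. if r = k then x else a r)"
  proof -
    have "us[i := x] ! card {..<r} = (if r = k then x else a r)" for r :: 'd
      using eq[of r] lt[of r] len by (auto simp: a_def nth_list_update)
    then show ?thesis
      by (simp add: row_det_def)
  qed
  have diff: "row_det (map (\<lambda>v. v - x) us) = det (\<chi> r. a r - x)"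
    using lt len by (simp add: row_det_def a_def)
  have "c0 *\<^sub>R x + (\<Sum>r\<in>UNIV. c (card {..<r}) *\<^sub>R a r) = 0"
    using rel sum.reindex_bij_betw[OF bij, of "\<lambda>i. c i *\<^sub>R us ! i"] by (simp add: a_def)
  moreover have "c0 + (\<Sum>r\<in>UNIV. c (card {..<r :: 'd})) = 1"
    using mass sum.reindex_bij_betw[OF bij, of c] by simp
  ultimately have "c0 * det (\<chi> r. if r = k then x else a r) = - (c i * det (\<chi> r. a r))"
    "c i * det (\<chi> r. a r - x) = - det (\<chi> r. if r = k then x else a r)"
    using barycentric_Cramer[of c0 x "\<lambda>r. c (card {..<r})" a k] by (simp_all add: k)
  then show "c0 * row_det (us[i := x]) = - (c i * row_det us)"
    and "c i * row_det (map (\<lambda>v. v - x) us) = - row_det (us[i := x])"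
    by (simp_all only: upd diff) (simp add: row_det_def a_def)
qed


section \<open>The closed form of an extreme law\<close>

lemma sum_support_listing:
  fixes p :: "real ^ 'k::finite" and g :: "'k \<Rightarrow> 'a::real_vector"
  assumes "distinct js" and "{i. p $ i \<noteq> 0} \<subseteq> set js"
  shows "(\<Sum>i<length js. p $ (js ! i) *\<^sub>R g (js ! i)) = (\<Sum>i\<in>UNIV. p $ i *\<^sub>R g i)"
proof -
  have "(\<Sum>i<length js. p $ (js ! i) *\<^sub>R g (js ! i)) = (\<Sum>i\<in>set js. p $ i *\<^sub>R g i)"
    using assms(1) by (intro sum.reindex_bij_betw bij_betw_nth) auto
  also have "\<dots> = (\<Sum>i\<in>UNIV. p $ i *\<^sub>R g i)"
    using assms(2) by (intro sum.mono_neutral_left) auto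
  finally show ?thesis .
qed

lemma law_Cramer:
  fixes \<xi> :: "'k::finite \<Rightarrow> real ^ 'd::{finite,linorder}"
  assumes p: "p \<in> risk_neutral_laws \<xi> UNIV"
    and js: "length js = CARD('d)" "distinct (j # js)" "{i. p $ i \<noteq> 0} \<subseteq> set (j # js)"
    and i: "i < CARD('d)"
  shows "p $ j * row_det ((map \<xi> js)[i := \<xi> j]) = - (p $ (js ! i) * row_det (map \<xi> js))"
    and "p $ (js ! i) * row_det (map (\<lambda>v. v - \<xi> j) (map \<xi> js)) = - row_det ((map \<xi> js)[i := \<xi> j])"
proof -
  have "p $ j *\<^sub>R \<xi> j + (\<Sum>i<CARD('d). p $ (js ! i) *\<^sub>R map \<xi> js ! i) = 0"
    using p sum_support_listing[OF js(2,3), of \<xi>] js(1)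
    by (simp add: risk_neutral_laws_def sum.lessThan_Suc_shift del: sum.lessThan_Suc)
  moreover have "p $ j + (\<Sum>i<CARD('d). p $ (js ! i)) = 1"
    using p sum_support_listing[OF js(2,3), of "\<lambda>_. 1 :: real"] js(1)
    by (simp add: risk_neutral_laws_def sum.lessThan_Suc_shift del: sum.lessThan_Suc)
  ultimately show "p $ j * row_det ((map \<xi> js)[i := \<xi> j]) = - (p $ (js ! i) * row_det (map \<xi> js))"
    and "p $ (js ! i) * row_det (map (\<lambda>v. v - \<xi> j) (map \<xi> js)) = - row_det ((map \<xi> js)[i := \<xi> j])"
    using row_det_Cramer[of "map \<xi> js" i "p $ j" "\<xi> j" "\<lambda>i. p $ (js ! i)"] js(1) i by simp_all
qed

text \<open>
  Comparing the two identities of Cramer's rule at any one index of positive weight identifies the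
  denominator as the determinant of the basis divided by the weight of the first vector.
\<close>

lemma law_eq_closed_form:
  fixes \<xi> :: "'k::finite \<Rightarrow> real ^ 'd::{finite,linorder}"
  assumes p: "p \<in> risk_neutral_laws \<xi> UNIV"
    and js: "length js = CARD('d) + 1" "distinct js" "set js = {i. p $ i \<noteq> 0}"
    and det: "row_det (tl (map \<xi> js)) \<noteq> 0" and i: "i < CARD('d) + 1"
  shows "p $ (js ! i) = closed_form_probability (map \<xi> js) i"
proof -
  obtain j ks where [simp]: "js = j # ks"
    using js(1) by (cases js) auto
  have len: "length ks = CARD('d)"
    using js(1) by simp
  define \<Delta> where "\<Delta> = row_det (map (\<lambda>v. v - \<xi> j) (map \<xi> ks))"
  have cramer: "p $ j * row_det ((map \<xi> ks)[m := \<xi> j]) = - (p $ (ks ! m) * row_det (map \<xi> ks))"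
    "p $ (ks ! m) * \<Delta> = - row_det ((map \<xi> ks)[m := \<xi> j])" if "m < CARD('d)" for m
    using law_Cramer[OF p len _ _ that, of j] js(2,3) by (simp_all add: \<Delta>_def)
  \<comment> \<open>Index \<open>0\<close> of \<open>ks\<close> exists because the dimension is positive.\<close>
  have "p $ j * \<Delta> = row_det (map \<xi> ks)"
  proof -
    have "ks ! 0 \<in> set js"
      using len by simp
    then have "p $ (ks ! 0) \<noteq> 0"
      using js(3) by auto
    moreover have "p $ (ks ! 0) * (p $ j * \<Delta>) = p $ (ks ! 0) * row_det (map \<xi> ks)"
      using cramer[of 0] by (simp add: mult.left_commute)
    ultimately show ?thesis
      by simp
  qed
  moreover from this have "\<Delta> \<noteq> 0"
    using det by auto
  ultimately show ?thesis
  proof (cases i)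
    case 0
    then show ?thesis
      using \<open>p $ j * \<Delta> = row_det (map \<xi> ks)\<close> \<open>\<Delta> \<noteq> 0\<close>
      by (simp add: closed_form_probability_def \<Delta>_def nonzero_eq_divide_eq)
  next
    case (Suc m)
    then have "m < CARD('d)"
      using i by simp
    then have "closed_form_probability (map \<xi> js) i =
        (- 1) ^ Suc m * ((- 1) ^ m * row_det ((map \<xi> ks)[m := \<xi> j])) / \<Delta>"
      using row_det_delete[of "map \<xi> ks" m "\<xi> j"] len
      by (simp add: closed_form_probability_def \<Delta>_def Suc)
    also have "\<dots> = - row_det ((map \<xi> ks)[m := \<xi> j]) / \<Delta>"
      by (simp flip: mult.assoc power_add mult_2)
    also have "\<dots> = p $ (ks ! m)"
      unfolding cramer(2)[OF \<open>m < CARD('d)\<close>, symmetric] using \<open>\<Delta> \<noteq> 0\<close> by simp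
    finally show ?thesis
      by (simp add: Suc)
  qed
qed

text \<open>
  Since the weights are positive, exchanging the first two vectors of a listing flips the
  orientation of its tail; this also covers \<open>d = 1\<close>, where the tail has no two entries to swap.
\<close>

lemma exists_oriented_support_listing:
  fixes \<xi> :: "'k::finite \<Rightarrow> real ^ 'd::{finite,linorder}"
  assumes gp: "general_position \<xi>"
    and ext: "p extreme_point_of risk_neutral_laws \<xi> UNIV"
  shows "\<exists>js. oriented_support_listing \<xi> p js"
proof -
  interpret general_position \<xi>
    by (fact gp)
  have p: "p \<in> risk_neutral_laws \<xi> UNIV" and card: "card {i. p $ i \<noteq> 0} = CARD('d) + 1"
    using ext unfolding extreme_law_iff by blast+
  have oriented: "oriented_support_listing \<xi> p js \<longleftrightarrow> 0 < row_det (tl (map \<xi> js))"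
    and nonzero: "row_det (tl (map \<xi> js)) \<noteq> 0"
    if js: "distinct js" "set js = {i. p $ i \<noteq> 0}" for js
  proof -
    have len: "length js = CARD('d) + 1"
      using card js distinct_card[of js] by simp
    have tl: "distinct (tl js)" "card (set (tl js)) = CARD('d)"
      using js(1) len distinct_card[of "tl js"] by (simp_all add: distinct_tl)
    show "row_det (tl (map \<xi> js)) \<noteq> 0"
      using span_subfamily[OF tl(2)] len by (intro row_det_nonzero) (simp_all flip: map_tl)
    show "oriented_support_listing \<xi> p js \<longleftrightarrow> 0 < row_det (tl (map \<xi> js))"
      using js len span_subfamily[OF tl(2)] independent[OF tl(2)] tl(1)
      by (simp add: oriented_support_listing_def positively_oriented_basis_def
          independent_subfamily_def distinct_map flip: map_tl)
  qed
  obtain js where js: "distinct js" "set js = {i. p $ i \<noteq> 0}"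
    using finite_distinct_list[of "{i. p $ i \<noteq> 0}"] by auto
  then have len: "length js = CARD('d) + 1"
    using card distinct_card[of js] by simp
  then obtain j j' ks where js_eq: "js = j # j' # ks"
    by (cases js rule: remdups_adj.cases) auto
  show ?thesis
  proof (cases "0 < row_det (tl (map \<xi> js))")
    case True
    then show ?thesis
      using oriented js by blast
  next
    case False
    then have "row_det (map \<xi> (j' # ks)) < 0"
      using nonzero[OF js] by (simp add: js_eq)
    moreover have pos: "0 < p $ j" "0 < p $ j'"
      using p js(2) by (auto simp: js_eq risk_neutral_laws_def less_le)
    moreover have "p $ j * row_det (map \<xi> (j # ks)) = - (p $ j' * row_det (map \<xi> (j' # ks)))"
      using law_Cramer(1)[OF p, of "j' # ks" j 0] js len by (simp add: js_eq)
    ultimately have "0 < p $ j * row_det (map \<xi> (j # ks))"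
      by (simp only:) (simp add: mult_pos_neg)
    then have "0 < row_det (tl (map \<xi> (j' # j # ks)))"
      using pos by (simp add: zero_less_mult_iff)
    moreover have "distinct (j' # j # ks)" "set (j' # j # ks) = {i. p $ i \<noteq> 0}"
      using js by (auto simp: js_eq)
    ultimately show ?thesis
      using oriented by blast
  qed
qed

theorem theorem4p1:
  fixes \<xi> :: "'k::finite \<Rightarrow> real ^ 'd::{finite,linorder}" and f :: "'k \<Rightarrow> real"
  assumes size: "CARD('d) \<le> CARD('k)"
    and nonvanishing: "\<forall>i. \<xi> i \<noteq> 0"
    and general_position: "\<forall>J. card J = CARD('d) \<longrightarrow> independent_subfamily \<xi> J"
    and no_direction: "no_positive_direction \<xi> UNIV"
  shows
    "(\<forall>I\<in>simplices \<xi>. \<exists>!p. p \<in> risk_neutral_laws \<xi> I) \<and>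
     simplices \<xi> \<noteq> {} \<and>
     (\<exists>\<gamma>. is_arg_min (\<lambda>\<gamma>. MAX i. f i - \<xi> i \<bullet> \<gamma>) (\<lambda>_. True) \<gamma> \<and>
          (MAX i. f i - \<xi> i \<bullet> \<gamma>) = (MAX I\<in>simplices \<xi>. risk_neutral_expectation \<xi> I f)) \<and>
     convex (risk_neutral_laws \<xi> UNIV) \<and>
     finite {p. p extreme_point_of risk_neutral_laws \<xi> UNIV} \<and>
     {p. p extreme_point_of risk_neutral_laws \<xi> UNIV} \<noteq> {} \<and>
     (MAX I\<in>simplices \<xi>. risk_neutral_expectation \<xi> I f) =
       (MAX p\<in>{p. p extreme_point_of risk_neutral_laws \<xi> UNIV}. average p f) \<and>
     (\<forall>p. p extreme_point_of risk_neutral_laws \<xi> UNIV \<longrightarrow>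
        (\<exists>js. oriented_support_listing \<xi> p js) \<and>
        (\<forall>js. oriented_support_listing \<xi> p js \<longrightarrow>
           (\<forall>i < CARD('d) + 1. p $ (js ! i) = closed_form_probability (map \<xi> js) i)))"
proof -
  interpret general_position \<xi>
    using size general_position by unfold_locales auto
  define E where "E = {p. p extreme_point_of risk_neutral_laws \<xi> UNIV}"
  define M where "M = (MAX p\<in>E. average p f)"
  have E_eq: "E = (\<lambda>I. THE p. p \<in> risk_neutral_laws \<xi> I) ` simplices \<xi>"
    unfolding E_def by (rule extreme_laws_eq_simplex_laws)
  then have "finite E"
    by simp
  have laws: "risk_neutral_laws \<xi> UNIV \<noteq> {}"
    using no_direction by (simp add: no_positive_direction_iff_law)
  then have "E \<noteq> {}"
    using extreme_point_exists_convex[OF compact_risk_neutral_laws convex_risk_neutral_laws]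
    unfolding E_def by blast
  then have "simplices \<xi> \<noteq> {}"
    using E_eq by blast
  have max_eq: "(MAX I\<in>simplices \<xi>. risk_neutral_expectation \<xi> I f) = M"
    unfolding M_def E_eq image_image risk_neutral_expectation_def ..
  have "average p f \<le> M" if "p \<in> E" for p
    using that \<open>finite E\<close> by (simp add: M_def)
  then have le_M: "average p f \<le> M" if "p \<in> risk_neutral_laws \<xi> UNIV" for p
    using average_le_on_laws[OF _ that, of f M] unfolding E_def by blast
  obtain q where "q \<in> E" and q: "average q f = M"
  proof -
    have "M \<in> (\<lambda>p. average p f) ` E"
      unfolding M_def using \<open>finite E\<close> \<open>E \<noteq> {}\<close> by (intro Max_in) auto
    then show thesis
      using that by auto
  qed
  then have "q \<in> risk_neutral_laws \<xi> UNIV"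
    by (simp add: E_def extreme_point_of_def)
  then have M_le: "M \<le> (MAX i. f i - \<xi> i \<bullet> \<gamma>)" for \<gamma>
    using average_le_Max[of q \<xi> f \<gamma>] by (simp add: q)
  obtain \<gamma> where "\<And>i. f i - \<xi> i \<bullet> \<gamma> \<le> M"
    using exists_dual_vector[OF laws le_M] by blast
  then have "(MAX i. f i - \<xi> i \<bullet> \<gamma>) \<le> M"
    by (intro Max.boundedI) auto
  then have \<gamma>: "(MAX i. f i - \<xi> i \<bullet> \<gamma>) = M"
    using M_le[of \<gamma>] by (rule antisym)
  then have min: "is_arg_min (\<lambda>\<gamma>. MAX i. f i - \<xi> i \<bullet> \<gamma>) (\<lambda>_. True) \<gamma>"
    unfolding is_arg_min_linorder \<gamma> using M_le by blast
  have closed_form: "p $ (js ! i) = closed_form_probability (map \<xi> js) i"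
    if "p extreme_point_of risk_neutral_laws \<xi> UNIV" "oriented_support_listing \<xi> p js"
      "i < CARD('d) + 1" for p js i
    using that by (intro law_eq_closed_form)
      (auto simp: extreme_point_of_def oriented_support_listing_def positively_oriented_basis_def)
  show ?thesis
    unfolding E_def[symmetric] M_def[symmetric] max_eq
    by (intro conjI ballI allI impI exI[of _ \<gamma>])
      (use ex1_law_in_simplex \<open>simplices \<xi> \<noteq> {}\<close> min \<gamma> convex_risk_neutral_laws \<open>finite E\<close> \<open>E \<noteq> {}\<close>
        exists_oriented_support_listing[OF general_position_axioms] closed_form in blast)+
qed

end
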